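(* Let $X$ be a Banach two-sided $\mathbb{H}$-module, let $D(A)$ be a right $\mathbb{H}$-submodule of $X$ and let $A : D(A)\to X$ be a closed right linear operator. Then $S_q^{-1}(A)\in\mathscr{L}^r(X)$ for every $q\in\rho_S(A)$, and $$S_p^{-1}(A)-S_q^{-1}(A)=Q_q(A)(q-p)+Q_q(A)\,S_p^{-1}(A)\,\triangle_q(p)\qquad\forall p,q\in\rho_S(A),$$ where $\triangle_q(p):=p^2-2\operatorname{Re}(q)p+|q|^2\in\mathbb{H}$.
   Context: $\mathbb{H}$ is the real algebra of quaternions with conjugation $q\mapsto\overline{q}$, real part $\operatorname{Re}(q)$ and norm $|q|=\sqrt{q\overline{q}}$; $\mathbb{R}\subset\mathbb{H}$ is the set of real quaternions. A two-sided $\mathbb{H}$-module is an abelian group $X$ with left and right scalar multiplications by $\mathbb{H}$, biadditive and unital, with $p(qx)=(pq)x$, $(xp)q=x(pq)$, $p(xq)=(px)q$ for $p,q\in\mathbb{H}$, and $rx=xr$ for $r\in\mathbb{R}$. It is a Banach two-sided $\mathbb{H}$-module if it has a norm (definite, subadditive) with $\|qx\|=\|xq\|=|q|\|x\|$ for which it is complete. A right $\mathbb{H}$-submodule is a subgroup closed under right scalar multiplication. A map $A:D(A)\to X$ on a right $\mathbb{H}$-submodule is right linear if it is additive and $A(xq)=A(x)q$; it is closed if its graph is closed in $X\times X$. $D(A^n):=\{x\in D(A^{n-1}):A^{n-1}x\in D(A)\}$, $A^nx:=A(A^{n-1}x)$, $A^0=\mathrm{Id}$. Operator-scalar products: $(qB)(x):=q\,B(x)$,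 and, when $D(B)$ is also closed under left scalar multiplication, $(Bq)(x):=B(qx)$; juxtaposition of operators is composition. $\mathscr{L}^r(X)$ is the set of right linear $B:X\to X$ with $\|B\|:=\sup\{\|Bx\|:\|x\|\le1\}<\infty$. For $q\in\mathbb{H}$, $\Delta_q(A):=A^2-2\operatorname{Re}(q)A+|q|^2\mathrm{Id}:D(A^2)\to X$. $\rho_S(A):=\{q\in\mathbb{H}:\Delta_q(A)\text{ is bijective and }\Delta_q(A)^{-1}\in\mathscr{L}^r(X)\}$. For $q\in\rho_S(A)$: $Q_q(A):=\Delta_q(A)^{-1}$ and $S_q^{-1}(A):=Q_q(A)\overline{q}-A\,Q_q(A):X\to X$ (a name for this operator, called the $S$-resolvent operator of $A$ at $q$). *)

theory Defs
  imports "HOL-Analysis.Analysis"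
begin

section \<open>Quaternions\<close>

datatype quat = Quat (qRe: real) (qIm1: real) (qIm2: real) (qIm3: real)

lemma quat_eq_iff:
  "p = q \<longleftrightarrow> qRe p = qRe q \<and> qIm1 p = qIm1 q \<and> qIm2 p = qIm2 q \<and> qIm3 p = qIm3 q"
  by (cases p; cases q) simp

instantiation quat :: ring_1
begin

definition "0 = Quat 0 0 0 0"
definition "1 = Quat 1 0 0 0"
definition "p + q = Quat (qRe p + qRe q) (qIm1 p + qIm1 q) (qIm2 p + qIm2 q) (qIm3 p + qIm3 q)"
definition "- q = Quat (- qRe q) (- qIm1 q) (- qIm2 q) (- qIm3 q)"
definition "p - q = Quat (qRe p - qRe q) (qIm1 p - qIm1 q) (qIm2 p - qIm2 q) (qIm3 p - qIm3 q)"
definition "p * q = Quat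
  (qRe p * qRe q - qIm1 p * qIm1 q - qIm2 p * qIm2 q - qIm3 p * qIm3 q)
  (qRe p * qIm1 q + qIm1 p * qRe q + qIm2 p * qIm3 q - qIm3 p * qIm2 q)
  (qRe p * qIm2 q - qIm1 p * qIm3 q + qIm2 p * qRe q + qIm3 p * qIm1 q)
  (qRe p * qIm3 q + qIm1 p * qIm2 q - qIm2 p * qIm1 q + qIm3 p * qRe q)"

instance
  by standard
    (simp_all add: quat_eq_iff zero_quat_def one_quat_def plus_quat_def uminus_quat_def
      minus_quat_def times_quat_def algebra_simps)

end

definition quat_cnj :: "quat \<Rightarrow> quat"
  where "quat_cnj q = Quat (qRe q) (- qIm1 q) (- qIm2 q) (- qIm3 q)"

instantiation quat :: real_algebra_1
begin

definition "scaleR r q = Quat (r * qRe q) (r * qIm1 q) (r * qIm2 q) (r * qIm3 q)"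

instance
  by standard
    (simp_all add: quat_eq_iff scaleR_quat_def plus_quat_def times_quat_def algebra_simps)

end

instantiation quat :: real_normed_div_algebra
begin

definition "norm q = sqrt ((qRe q)\<^sup>2 + (qIm1 q)\<^sup>2 + (qIm2 q)\<^sup>2 + (qIm3 q)\<^sup>2)"

definition "sgn (q::quat) = q /\<^sub>R norm q"

definition "dist p (q::quat) = norm (p - q)"

definition [code del]:
  "(uniformity :: (quat \<times> quat) filter) = (INF e\<in>{0 <..}. principal {(x, y). dist x y < e})"

definition [code del]:
  "open (U :: quat set) \<longleftrightarrow> (\<forall>x\<in>U. eventually (\<lambda>(x', y). x' = x \<longrightarrow> y \<in> U) uniformity)"

definition "inverse q = quat_cnj q /\<^sub>R (norm q)\<^sup>2"

definition "p div (q::quat) = p * inverse q"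

instance
proof
  fix r :: real and x y z :: quat
  note defs = quat_eq_iff zero_quat_def one_quat_def plus_quat_def uminus_quat_def
      minus_quat_def times_quat_def scaleR_quat_def quat_cnj_def
  have norm_prod: "norm q = norm (qRe q, qIm1 q, qIm2 q, qIm3 q)" for q
    by (simp add: norm_quat_def norm_Pair add.assoc)
  have norm_sq: "(norm q)\<^sup>2 = (qRe q)\<^sup>2 + (qIm1 q)\<^sup>2 + (qIm2 q)\<^sup>2 + (qIm3 q)\<^sup>2" for q :: quat
    by (simp add: norm_quat_def)
  show "sgn x = x /\<^sub>R norm x" "dist x y = norm (x - y)"
    "(uniformity :: (quat \<times> quat) filter) = (INF e\<in>{0 <..}. principal {(x, y). dist x y < e})"
    "x div y = x * inverse y"
    by (simp_all add: sgn_quat_def dist_quat_def uniformity_quat_def divide_quat_def)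
  show "open U \<longleftrightarrow> (\<forall>x\<in>U. eventually (\<lambda>(x', y). x' = x \<longrightarrow> y \<in> U) uniformity)" for U :: "quat set"
    by (simp add: open_quat_def)
  show n0: "norm x = 0 \<longleftrightarrow> x = 0" for x :: quat
    by (simp add: norm_prod defs zero_prod_def)
  show "norm (x + y) \<le> norm x + norm y"
    using norm_triangle_ineq[of "(qRe x, qIm1 x, qIm2 x, qIm3 x)" "(qRe y, qIm1 y, qIm2 y, qIm3 y)"]
    by (simp add: norm_prod plus_quat_def)
  show "norm (r *\<^sub>R x) = \<bar>r\<bar> * norm x"
    using norm_scaleR[of r "(qRe x, qIm1 x, qIm2 x, qIm3 x)"]
    by (simp add: norm_prod scaleR_quat_def)
  have "(norm (x * y))\<^sup>2 = (norm x * norm y)\<^sup>2"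
    unfolding power_mult_distrib norm_sq times_quat_def quat.sel
    by (simp add: power2_eq_square algebra_simps)
  then show "norm (x * y) = norm x * norm y"
    by (rule power2_eq_imp_eq) (simp_all add: norm_prod)
  show "inverse (0::quat) = 0"
    by (simp add: inverse_quat_def defs)
  { assume "x \<noteq> 0"
    then have "(norm x)\<^sup>2 \<noteq> 0"
      using n0 by simp
    moreover have "quat_cnj x * x = Quat ((norm x)\<^sup>2) 0 0 0" "x * quat_cnj x = Quat ((norm x)\<^sup>2) 0 0 0"
      unfolding norm_sq by (simp_all add: defs power2_eq_square algebra_simps)
    moreover have "(c *\<^sub>R quat_cnj x) * x = c *\<^sub>R (quat_cnj x * x)"
      "x * (c *\<^sub>R quat_cnj x) = c *\<^sub>R (x * quat_cnj x)" for c
      by (simp_all add: defs algebra_simps)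
    ultimately show "inverse x * x = 1" "x * inverse x = 1"
      by (simp_all add: inverse_quat_def scaleR_quat_def one_quat_def) }
qed

end

lemma quat_mult_cnj: "q * quat_cnj q = of_real ((norm q)\<^sup>2)"
  by (simp add: quat_eq_iff Real_Vector_Spaces.of_real_def scaleR_quat_def one_quat_def times_quat_def quat_cnj_def
      norm_quat_def power2_eq_square)

lemma norm_quat_eq: "norm q = sqrt (qRe (q * quat_cnj q))"
  by (simp add: times_quat_def quat_cnj_def norm_quat_def power2_eq_square)


section \<open>Banach two-sided modules over the quaternions\<close>

text \<open>
  The real vector space structure is the one induced by the real quaternions; the last two
  axioms of \<open>quat_bimodule\<close> express this and entail \<open>r x = x r\<close> for real \<open>r\<close>.
\<close>

class quat_bimodule = real_vector +
  fixes lmul :: "quat \<Rightarrow> 'a \<Rightarrow> 'a"  (infixr "*\<^sub>l" 75)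
    and rmul :: "'a \<Rightarrow> quat \<Rightarrow> 'a"  (infixl "*\<^sub>r" 75)
  assumes lmul_add_right: "q *\<^sub>l (x + y) = q *\<^sub>l x + q *\<^sub>l y"
    and lmul_add_left: "(p + q) *\<^sub>l x = p *\<^sub>l x + q *\<^sub>l x"
    and rmul_add_left: "(x + y) *\<^sub>r q = x *\<^sub>r q + y *\<^sub>r q"
    and rmul_add_right: "x *\<^sub>r (p + q) = x *\<^sub>r p + x *\<^sub>r q"
    and lmul_one: "1 *\<^sub>l x = x"
    and rmul_one: "x *\<^sub>r 1 = x"
    and lmul_lmul: "p *\<^sub>l (q *\<^sub>l x) = (p * q) *\<^sub>l x"
    and rmul_rmul: "(x *\<^sub>r p) *\<^sub>r q = x *\<^sub>r (p * q)"
    and lmul_rmul: "p *\<^sub>l (x *\<^sub>r q) = (p *\<^sub>l x) *\<^sub>r q"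
    and lmul_of_real: "of_real r *\<^sub>l x = r *\<^sub>R x"
    and rmul_of_real: "x *\<^sub>r of_real r = r *\<^sub>R x"

class quat_banach_bimodule = quat_bimodule + banach +
  assumes norm_lmul: "norm (q *\<^sub>l x) = norm q * norm x"
    and norm_rmul: "norm (x *\<^sub>r q) = norm q * norm x"

instance quat :: banach
proof
  fix X :: "nat \<Rightarrow> quat"
  assume "Cauchy X"
  define F where "F q = (qRe q, qIm1 q, qIm2 q, qIm3 q)" for q
  have dF: "dist (F p) (F q) = dist p q" for p q
    by (simp add: F_def dist_norm norm_quat_def norm_Pair minus_quat_def add.assoc)
  from \<open>Cauchy X\<close> have "Cauchy (\<lambda>n. F (X n))"
    by (simp add: Cauchy_def dF)
  then obtain l where l: "(\<lambda>n. F (X n)) \<longlonglongrightarrow> l"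
    using Cauchy_convergent convergent_def by blast
  obtain a b c d where "l = (a, b, c, d)"
    by (cases l)
  then have "l = F (Quat a b c d)"
    by (simp add: F_def)
  with l have "X \<longlonglongrightarrow> Quat a b c d"
    by (simp add: tendsto_iff dF)
  then show "convergent X"
    by (auto simp: convergent_def)
qed

instantiation quat :: quat_banach_bimodule
begin

definition "lmul_quat p (q::quat) = p * q"
definition "rmul_quat p (q::quat) = p * q"

instance
  by standard
    (simp_all add: lmul_quat_def rmul_quat_def algebra_simps norm_mult of_real_def)

end


section \<open>Right linear operators\<close>

text \<open>
  An operator with domain \<open>D\<close> is a total function \<open>A\<close> of which only the values on \<open>D\<close> matter.
\<close>

definition right_submodule :: "'a::quat_bimodule set \<Rightarrow> bool"
  where "right_submodule D \<longleftrightarrow>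
    0 \<in> D \<and> (\<forall>x\<in>D. \<forall>y\<in>D. x + y \<in> D) \<and> (\<forall>x\<in>D. - x \<in> D) \<and> (\<forall>x\<in>D. \<forall>q. x *\<^sub>r q \<in> D)"

definition right_linear_on :: "'a::quat_bimodule set \<Rightarrow> ('a \<Rightarrow> 'a) \<Rightarrow> bool"
  where "right_linear_on D A \<longleftrightarrow>
    (\<forall>x\<in>D. \<forall>y\<in>D. A (x + y) = A x + A y) \<and> (\<forall>x\<in>D. \<forall>q. A (x *\<^sub>r q) = A x *\<^sub>r q)"

definition closed_operator :: "'a::topological_space set \<Rightarrow> ('a \<Rightarrow> 'a) \<Rightarrow> bool"
  where "closed_operator D A \<longleftrightarrow> closed {(x, A x) | x. x \<in> D}"

primrec dom_pow :: "'a set \<Rightarrow> ('a \<Rightarrow> 'a) \<Rightarrow> nat \<Rightarrow> 'a set"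
  where "dom_pow D A 0 = UNIV"
  | "dom_pow D A (Suc n) = {x \<in> dom_pow D A n. (A ^^ n) x \<in> D}"

text \<open>The operator-scalar product \<open>B q\<close>, for \<open>B\<close> defined on the whole module.\<close>

definition op_scal :: "('a::quat_bimodule \<Rightarrow> 'a) \<Rightarrow> quat \<Rightarrow> 'a \<Rightarrow> 'a"  (infixl "\<odot>" 70)
  where "(B \<odot> q) = (\<lambda>x. B (q *\<^sub>l x))"

definition bounded_right_linear :: "('a::quat_banach_bimodule \<Rightarrow> 'a) set"
  where "bounded_right_linear =
    {B. right_linear_on UNIV B \<and> bdd_above ((\<lambda>x. norm (B x)) ` {x. norm x \<le> 1})}"


section \<open>Spherical resolvent set and resolvent operator\<close>

text \<open>
  \<open>Delta_op A q\<close> is to be regarded as an operator with domain \<open>dom_pow D A 2\<close>.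
\<close>

definition Delta_op :: "('a::quat_bimodule \<Rightarrow> 'a) \<Rightarrow> quat \<Rightarrow> 'a \<Rightarrow> 'a"
  where "Delta_op A q x = (A ^^ 2) x - (2 * qRe q) *\<^sub>R A x + (norm q)\<^sup>2 *\<^sub>R x"

definition Q_op :: "'a::quat_bimodule set \<Rightarrow> ('a \<Rightarrow> 'a) \<Rightarrow> quat \<Rightarrow> 'a \<Rightarrow> 'a"
  where "Q_op D A q = inv_into (dom_pow D A 2) (Delta_op A q)"

definition S_resolvent_set :: "'a::quat_banach_bimodule set \<Rightarrow> ('a \<Rightarrow> 'a) \<Rightarrow> quat set"
  where "S_resolvent_set D A =
    {q. bij_betw (Delta_op A q) (dom_pow D A 2) UNIV \<and> Q_op D A q \<in> bounded_right_linear}"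

definition S_resolvent_op :: "'a::quat_bimodule set \<Rightarrow> ('a \<Rightarrow> 'a) \<Rightarrow> quat \<Rightarrow> 'a \<Rightarrow> 'a"
  where "S_resolvent_op D A q = (\<lambda>x. (Q_op D A q \<odot> quat_cnj q) x - A (Q_op D A q x))"

definition quat_Delta :: "quat \<Rightarrow> quat \<Rightarrow> quat"
  where "quat_Delta q p = p\<^sup>2 - of_real (2 * qRe q) * p + of_real ((norm q)\<^sup>2)"

end

theory Submission
  imports Defs
begin

text \<open>
  Below, \<open>S\<^sub>p\<close> is the resolvent operator at \<open>p\<close> and \<open>Q\<^sub>p\<close> the inverse of \<open>\<Delta>\<^sub>p(A)\<close>.

  Boundedness. \<open>Q\<^sub>q\<close> is bounded by assumption, so everything depends on \<open>A Q\<^sub>q\<close>. This operator is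
  defined everywhere because \<open>Q\<^sub>q\<close> maps into \<open>D(A\<^sup>2)\<close>, and it has a closed graph because \<open>A\<close> is
  closed and \<open>Q\<^sub>q\<close> is continuous; the closed graph theorem, proved here from Baire's theorem, makes
  it bounded.

  Resolvent equation. Left multiplication need neither preserve \<open>D(A)\<close> nor commute with \<open>A\<close>, so
  scalars cannot be moved past \<open>A\<close> or \<open>Q\<^sub>q\<close>. What replaces this is the left resolvent identity
  \<open>S\<^sub>p(p x) = A(S\<^sub>p x) + x\<close>, which holds because \<open>p + p\<^sup>*\<close> and \<open>p\<^sup>* p\<close> are real (\<open>p\<^sup>*\<close> being the
  conjugate). Applied twice, it writes \<open>S\<^sub>p(\<Delta>\<^sub>q(p) x)\<close> as a real combination of \<open>A(S\<^sub>p(p x))\<close>,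
  \<open>A(S\<^sub>p x)\<close>, \<open>S\<^sub>p x\<close>, \<open>p x\<close> and \<open>x\<close>. The equation is then checked after moving the term
  \<open>A Q\<^sub>q x\<close> to the other side: it says that \<open>Q\<^sub>q\<close> takes a certain vector to
  \<open>w = S\<^sub>p x + A Q\<^sub>q x\<close>, that is, that \<open>w\<close> lies in \<open>D(A\<^sup>2)\<close> and \<open>\<Delta>\<^sub>q(A) w\<close> is this vector.
  Neither summand of \<open>w\<close> need lie in \<open>D(A\<^sup>2)\<close>, but
  \<open>A w = S\<^sub>p(p x) + 2 Re(q) A Q\<^sub>q x - |q|\<^sup>2 Q\<^sub>q x\<close>, and the right-hand side does lie in \<open>D(A)\<close>.
\<close>

section \<open>The closed graph theorem\<close>

text \<open>
  By Baire's theorem the closure of some set \<open>{x. norm (T x) \<le> n}\<close> contains a ball. Differences of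
  points of the set then approximate every vector of a ball around the origin, and rescaling gives
  the bound for every vector.
\<close>

lemma linear_approximation_bounded_image:
  fixes T :: "'a::banach \<Rightarrow> 'b::real_normed_vector"
  assumes "linear T"
  obtains c where "c \<ge> 0" "\<And>y. \<exists>u. norm (y - u) \<le> norm y / 2 \<and> norm (T u) \<le> c * norm y"
proof -
  interpret linear T by fact
  define V where "V n = {x. norm (T x) \<le> real n}" for n
  have cover: "(\<Union>n. closure (V n)) = UNIV"
  proof -
    have "\<exists>n. x \<in> V n" for x
      unfolding V_def using real_arch_simple by auto
    then show ?thesis
      using closure_subset by blast
  qed
  have "\<exists>n. interior (closure (V n)) \<noteq> {}"
  proof (rule ccontr)
    assume "\<not> ?thesis"
    then have "euclidean interior_of \<Union>(range (\<lambda>n. closure (V n))) = {}"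
      by (intro Baire_category_alt)
        (auto simp: completely_metrizable_space_euclidean)
    then show False
      using cover by simp
  qed
  then obtain n x0 where "x0 \<in> interior (closure (V n))"
    by blast
  then obtain r where r: "r > 0" "cball x0 r \<subseteq> closure (V n)"
    by (meson interior_subset mem_interior_cball)
  define c where "c = 2 * real n / r"
  have "\<exists>u. norm (y - u) \<le> norm y / 2 \<and> norm (T u) \<le> c * norm y" for y
  proof (cases "y = 0")
    case True
    then show ?thesis
      by (intro exI[of _ 0]) (simp add: zero)
  next
    case False
    define s where "s = r / norm y"
    have s: "s > 0"
      using False r by (simp add: s_def)
    have "x0 + s *\<^sub>R y \<in> closure (V n)" "x0 \<in> closure (V n)"
      using r False by (auto intro!: subsetD[OF r(2)] simp: dist_norm s_def)
    moreover have "r / 4 > 0"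
      using r by simp
    ultimately obtain a b where a: "a \<in> V n" "dist a (x0 + s *\<^sub>R y) < r / 4"
      and b: "b \<in> V n" "dist b x0 < r / 4"
      unfolding closure_approachable by metis
    define u where "u = (a - b) /\<^sub>R s"
    have "s *\<^sub>R (y - u) = (b - x0) - (a - (x0 + s *\<^sub>R y))"
      using s by (simp add: u_def algebra_simps)
    then have "s * norm (y - u) = norm ((b - x0) - (a - (x0 + s *\<^sub>R y)))"
      using s by (metis abs_of_pos norm_scaleR)
    also have "\<dots> \<le> r / 2"
      using a(2) b(2) norm_triangle_ineq4[of "b - x0" "a - (x0 + s *\<^sub>R y)"]
      by (simp add: dist_norm)
    finally have 1: "norm (y - u) \<le> norm y / 2"
      using s r False by (simp add: s_def field_simps)
    have "norm (T a - T b) \<le> 2 * real n"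
      using a(1) b(1) norm_triangle_ineq4[of "T a" "T b"] by (simp add: V_def)
    then have "norm (T u) \<le> 2 * real n / s"
      using s by (simp add: u_def scale diff divide_inverse mult.commute)
    then have "norm (T u) \<le> c * norm y"
      by (simp add: c_def s_def)
    with 1 show ?thesis by blast
  qed
  moreover have "c \<ge> 0"
    using r by (simp add: c_def)
  ultimately show thesis
    using that by blast
qed

text \<open>
  Repeated approximation halves the remainder \<open>y\<^sub>k\<close> each time, at a cost of \<open>c * norm y\<^sub>k\<close> in the
  image. The images \<open>T y\<^sub>k\<close> therefore converge, and since \<open>y\<^sub>k\<close> tends to \<open>0\<close>, the closed graph forces
  their limit to be \<open>0\<close>; so \<open>T y\<close> is the sum of the images of the approximants, which is controlled
  by a geometric series.
\<close>

theorem closed_graph_theorem: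
  fixes T :: "'a::banach \<Rightarrow> 'b::banach"
  assumes lin: "linear T" and clo: "closed (range (\<lambda>x. (x, T x)))"
  shows "bounded_linear T"
proof -
  interpret linear T by fact
  obtain c where c: "c \<ge> 0" "\<And>y. \<exists>u. norm (y - u) \<le> norm y / 2 \<and> norm (T u) \<le> c * norm y"
    using linear_approximation_bounded_image[OF lin] by blast
  then obtain g where g: "\<And>y. norm (y - g y) \<le> norm y / 2" "\<And>y. norm (T (g y)) \<le> c * norm y"
    by metis
  have "norm (T y) \<le> norm y * (2 * c)" for y
  proof -
    define z where "z k = ((\<lambda>y. y - g y) ^^ k) y" for k
    have z: "z 0 = y" "z (Suc k) = z k - g (z k)" for k
      by (simp_all add: z_def)
    have nz: "norm (z k) \<le> norm y * (1/2)^k" for k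
    proof (induction k)
      case (Suc k)
      then show ?case
        using g(1)[of "z k"] by (simp add: z)
    qed (simp add: z)
    have geo: "(\<lambda>k. c * norm y * (1/2)^k) sums (c * norm y * 2)"
      using sums_mult[OF geometric_sums[of "1/2::real"], of "c * norm y"] by simp
    have bd: "norm (T (g (z k))) \<le> c * norm y * (1/2)^k" for k
      using order_trans[OF g(2) mult_left_mono[OF nz c(1)]] by (simp add: mult.assoc)
    have partial: "(\<Sum>k<N. T (g (z k))) = T y - T (z N)" for N
      by (induction N) (simp_all add: z diff)
    have summ: "summable (\<lambda>k. T (g (z k)))"
      by (rule summable_comparison_test'[OF sums_summable[OF geo]]) (rule bd)
    then obtain w where w: "(\<lambda>N. T y - T (z N)) \<longlonglongrightarrow> w"
      unfolding summable_def sums_def partial by blast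
    have "(\<lambda>k. norm y * (1/2)^k) \<longlonglongrightarrow> norm y * 0"
      by (intro tendsto_intros LIMSEQ_power_zero) auto
    then have z0: "z \<longlonglongrightarrow> 0"
      by (intro Lim_null_comparison[of z "\<lambda>k. norm y * (1/2)^k"]) (use nz in auto)
    have "(\<lambda>N. T y - (T y - T (z N))) \<longlonglongrightarrow> T y - w"
      by (intro tendsto_intros w)
    then have "(\<lambda>N. (z N, T (z N))) \<longlonglongrightarrow> (0, T y - w)"
      by (intro tendsto_Pair z0) simp
    then have "(0, T y - w) \<in> range (\<lambda>x. (x, T x))"
      by (rule closed_sequentially[OF clo, rotated]) auto
    then have "w = T y"
      by (auto simp: zero)
    then have "suminf (\<lambda>k. T (g (z k))) = T y"
      using w by (simp add: sums_def partial sums_unique[symmetric])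
    moreover have "norm (suminf (\<lambda>k. T (g (z k)))) \<le> c * norm y * 2"
      using norm_suminf_le[OF bd sums_summable[OF geo]] geo by (simp add: sums_iff)
    ultimately show ?thesis
      by (simp add: mult_ac)
  qed
  then show ?thesis
    using lin by (intro bounded_linear_intro) (auto simp: add scale)
qed

section \<open>Right linear operators\<close>

lemma right_submodule_add: "right_submodule D \<Longrightarrow> x \<in> D \<Longrightarrow> y \<in> D \<Longrightarrow> x + y \<in> D"
  by (simp add: right_submodule_def)

lemma right_submodule_scaleR: "right_submodule D \<Longrightarrow> x \<in> D \<Longrightarrow> r *\<^sub>R x \<in> D"
  unfolding right_submodule_def by (metis rmul_of_real)

lemma right_submodule_diff: "right_submodule D \<Longrightarrow> x \<in> D \<Longrightarrow> y \<in> D \<Longrightarrow> x - y \<in> D"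
  unfolding right_submodule_def by (metis diff_conv_add_uminus)

lemma right_linear_on_add: "right_linear_on D A \<Longrightarrow> x \<in> D \<Longrightarrow> y \<in> D \<Longrightarrow> A (x + y) = A x + A y"
  by (simp add: right_linear_on_def)

lemma right_linear_on_scaleR: "right_linear_on D A \<Longrightarrow> x \<in> D \<Longrightarrow> A (r *\<^sub>R x) = r *\<^sub>R A x"
  unfolding right_linear_on_def by (metis rmul_of_real)

lemma right_linear_on_diff:
  assumes "right_submodule D" "right_linear_on D A" "x \<in> D" "y \<in> D"
  shows "A (x - y) = A x - A y"
  using right_linear_on_add[OF assms(2) right_submodule_diff[OF assms(1,3,4)] assms(4)]
  by simp

lemma rmul_diff_left: "(x - y) *\<^sub>r q = x *\<^sub>r q - y *\<^sub>r (q::quat)"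
  by (metis add_diff_cancel diff_add_cancel rmul_add_left)

lemma right_linear_on_UNIV_linear: "right_linear_on UNIV B \<Longrightarrow> linear B"
  by (intro linearI) (simp_all add: right_linear_on_add right_linear_on_scaleR)

text \<open>Right multiplication by a real scalar is scalar multiplication, so the unit ball bound
  rescales.\<close>

lemma bounded_right_linear_iff:
  "B \<in> bounded_right_linear \<longleftrightarrow> right_linear_on UNIV B \<and> bounded_linear B"
proof
  assume B: "B \<in> bounded_right_linear"
  then have rl: "right_linear_on UNIV B"
    and "bdd_above ((\<lambda>x. norm (B x)) ` {x. norm x \<le> 1})"
    by (auto simp: bounded_right_linear_def)
  then obtain M where M: "\<And>x. norm x \<le> 1 \<Longrightarrow> norm (B x) \<le> M"
    by (auto simp: bdd_above_def)
  interpret linear B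
    using right_linear_on_UNIV_linear[OF rl] .
  have "norm (B x) \<le> norm x * M" for x
  proof (cases "x = 0")
    case False
    then show ?thesis
      using M[of "x /\<^sub>R norm x"] by (simp add: scale field_simps)
  qed (simp add: zero)
  with rl show "right_linear_on UNIV B \<and> bounded_linear B"
    by (auto intro!: bounded_linear_intro simp: add scale)
next
  assume B: "right_linear_on UNIV B \<and> bounded_linear B"
  then obtain K where K: "K > 0" "\<And>x. norm (B x) \<le> norm x * K"
    using bounded_linear.pos_bounded by blast
  have "norm (B x) \<le> K" if "norm x \<le> 1" for x
    using order_trans[OF K(2)[of x] mult_right_mono[OF that, of K]] K(1) by simp
  with B show "B \<in> bounded_right_linear"
    by (auto simp: bounded_right_linear_def bdd_above_def)
qed

lemma bounded_linear_lmul: "bounded_linear ((*\<^sub>l) q :: 'a::quat_banach_bimodule \<Rightarrow> 'a)"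
proof (rule bounded_linear_intro[where K = "norm q"])
  fix r and x :: 'a
  show "q *\<^sub>l (r *\<^sub>R x) = r *\<^sub>R (q *\<^sub>l x)"
    by (metis lmul_rmul rmul_of_real)
qed (simp_all add: lmul_add_right norm_lmul mult.commute)

lemma op_scal_bounded_right_linear:
  assumes "B \<in> bounded_right_linear"
  shows "B \<odot> q \<in> bounded_right_linear"
  using assms bounded_linear_compose[OF _ bounded_linear_lmul]
  by (auto simp: bounded_right_linear_iff op_scal_def right_linear_on_def lmul_add_right lmul_rmul)

section \<open>The pseudo-resolvent\<close>

lemma mem_dom_pow_2: "x \<in> dom_pow D A 2 \<longleftrightarrow> x \<in> D \<and> A x \<in> D"
  by (simp add: numeral_2_eq_2)

lemma Delta_op_eq: "Delta_op A q x = A (A x) - (2 * qRe q) *\<^sub>R A x + (norm q)\<^sup>2 *\<^sub>R x"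
  by (simp add: Delta_op_def numeral_2_eq_2)

context
  fixes A :: "'a::quat_banach_bimodule \<Rightarrow> 'a" and D :: "'a set" and q :: quat
  assumes q: "q \<in> S_resolvent_set D A"
begin

lemma Q_op_bounded_right_linear: "Q_op D A q \<in> bounded_right_linear"
  using q by (simp add: S_resolvent_set_def)

lemma Q_op_linear: "linear (Q_op D A q)"
  using Q_op_bounded_right_linear right_linear_on_UNIV_linear bounded_right_linear_iff by blast

lemma Q_op_mem: "Q_op D A q x \<in> D" "A (Q_op D A q x) \<in> D"
proof -
  have "Delta_op A q ` dom_pow D A 2 = UNIV"
    using q by (simp add: S_resolvent_set_def bij_betw_def)
  then have "Q_op D A q x \<in> dom_pow D A 2"
    unfolding Q_op_def by (intro inv_into_into) simp
  then show "Q_op D A q x \<in> D" "A (Q_op D A q x) \<in> D"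
    by (simp_all add: mem_dom_pow_2)
qed

lemma A_A_Q_op:
  "A (A (Q_op D A q x)) = x + (2 * qRe q) *\<^sub>R A (Q_op D A q x) - (norm q)\<^sup>2 *\<^sub>R Q_op D A q x"
proof -
  have "Delta_op A q (Q_op D A q x) = x"
    using q by (auto simp: S_resolvent_set_def Q_op_def intro: bij_betw_inv_into_right)
  then show ?thesis
    by (simp add: Delta_op_eq algebra_simps)
qed

lemma Q_op_Delta_op:
  assumes "w \<in> D" "A w \<in> D"
  shows "Q_op D A q (Delta_op A q w) = w"
  using q assms
  by (auto simp: S_resolvent_set_def Q_op_def mem_dom_pow_2 intro: bij_betw_inv_into_left)

end

text \<open>
  Continuity of \<open>Q\<^sub>q\<close> turns a convergent sequence in the graph of \<open>A Q\<^sub>q\<close> into one in the graph of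
  \<open>A\<close>.
\<close>

lemma A_Q_op_bounded_right_linear:
  fixes A :: "'a::quat_banach_bimodule \<Rightarrow> 'a"
  assumes A: "right_linear_on D A" "closed_operator D A" and q: "q \<in> S_resolvent_set D A"
  shows "(\<lambda>x. A (Q_op D A q x)) \<in> bounded_right_linear"
proof -
  let ?Q = "Q_op D A q"
  have Q: "right_linear_on UNIV ?Q" "bounded_linear ?Q"
    using Q_op_bounded_right_linear[OF q] by (auto simp: bounded_right_linear_iff)
  have rl: "right_linear_on UNIV (\<lambda>x. A (?Q x))"
    using Q(1) A(1) Q_op_mem[OF q] by (simp add: right_linear_on_def)
  moreover have "bounded_linear (\<lambda>x. A (?Q x))"
  proof (rule closed_graph_theorem)
    show "linear (\<lambda>x. A (?Q x))"
      using rl by (rule right_linear_on_UNIV_linear)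
    show "closed (range (\<lambda>x. (x, A (?Q x))))"
      unfolding closed_sequential_limits
    proof (intro allI impI, elim conjE)
      fix f l
      assume f: "\<forall>n. f n \<in> range (\<lambda>x. (x, A (?Q x)))" and lim: "f \<longlonglongrightarrow> l"
      define x where "x n = fst (f n)" for n
      have "f n = (x n, A (?Q (x n)))" for n
        using f[rule_format, of n] by (auto simp: x_def)
      with lim have x: "x \<longlonglongrightarrow> fst l" and y: "(\<lambda>n. A (?Q (x n))) \<longlonglongrightarrow> snd l"
        using tendsto_fst[OF lim] tendsto_snd[OF lim] by simp_all
      have "(\<lambda>n. (?Q (x n), A (?Q (x n)))) \<longlonglongrightarrow> (?Q (fst l), snd l)"
        by (intro tendsto_Pair y bounded_linear.tendsto[OF Q(2)] x)
      then have "(?Q (fst l), snd l) \<in> {(x, A x) | x. x \<in> D}"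
        using A(2) unfolding closed_operator_def
        by (rule closed_sequentially[rotated 2]) (use Q_op_mem[OF q] in auto)
      then show "l \<in> range (\<lambda>x. (x, A (?Q x)))"
        by (auto simp: image_iff prod_eq_iff)
    qed
  qed
  ultimately show ?thesis
    by (simp add: bounded_right_linear_iff)
qed

lemma S_resolvent_op_bounded_right_linear:
  fixes A :: "'a::quat_banach_bimodule \<Rightarrow> 'a"
  assumes "right_linear_on D A" "closed_operator D A" "q \<in> S_resolvent_set D A"
  shows "S_resolvent_op D A q \<in> bounded_right_linear"
proof -
  have "Q_op D A q \<odot> quat_cnj q \<in> bounded_right_linear"
    using assms(3) by (intro op_scal_bounded_right_linear Q_op_bounded_right_linear)
  with A_Q_op_bounded_right_linear[OF assms] show ?thesis
    unfolding S_resolvent_op_def bounded_right_linear_iff right_linear_on_def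
    by (simp add: bounded_linear_sub rmul_diff_left)
qed

section \<open>The resolvent equation\<close>

lemma quat_cnj_mult: "quat_cnj q * q = of_real ((norm q)\<^sup>2)"
  by (simp add: quat_eq_iff Real_Vector_Spaces.of_real_def scaleR_quat_def one_quat_def
      times_quat_def quat_cnj_def norm_quat_def power2_eq_square)

lemma quat_cnj_eq: "quat_cnj q = of_real (2 * qRe q) - q"
  by (simp add: quat_eq_iff Real_Vector_Spaces.of_real_def scaleR_quat_def one_quat_def
      minus_quat_def quat_cnj_def)

lemma lmul_diff_left: "(p - q) *\<^sub>l x = p *\<^sub>l x - q *\<^sub>l (x::'a::quat_bimodule)"
  by (metis add_diff_cancel diff_add_cancel lmul_add_left)

lemma S_resolvent_op_eq:
  "S_resolvent_op D A q x = Q_op D A q (quat_cnj q *\<^sub>l x) - A (Q_op D A q x)"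
  by (simp add: S_resolvent_op_def op_scal_def)

lemma S_resolvent_op_mem:
  fixes A :: "'a::quat_banach_bimodule \<Rightarrow> 'a"
  assumes "right_submodule D" "q \<in> S_resolvent_set D A"
  shows "S_resolvent_op D A q x \<in> D"
  unfolding S_resolvent_op_eq
  by (intro right_submodule_diff[OF assms(1)] Q_op_mem[OF assms(2)])

text \<open>
  The left resolvent identity. Both \<open>p\<^sup>* p = |p|\<^sup>2\<close> and \<open>p + p\<^sup>* = 2 Re(p)\<close> are real and hence commute
  with \<open>A\<close> and \<open>Q\<^sub>p\<close>, so \<open>S\<^sub>p(p x) - A(S\<^sub>p x)\<close> collapses to \<open>\<Delta>\<^sub>p(A) Q\<^sub>p x = x\<close>.
\<close>

lemma S_resolvent_op_lmul:
  fixes A :: "'a::quat_banach_bimodule \<Rightarrow> 'a"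
  assumes D: "right_submodule D" and A: "right_linear_on D A" and p: "p \<in> S_resolvent_set D A"
  shows "S_resolvent_op D A p (p *\<^sub>l x) = A (S_resolvent_op D A p x) + x"
proof -
  let ?Q = "Q_op D A p"
  interpret Q: linear ?Q
    using Q_op_linear[OF p] .
  note mem = Q_op_mem[OF p]
  have 1: "?Q (quat_cnj p *\<^sub>l (p *\<^sub>l x)) = (norm p)\<^sup>2 *\<^sub>R ?Q x"
    by (simp only: lmul_lmul quat_cnj_mult lmul_of_real Q.scale)
  have "?Q (quat_cnj p *\<^sub>l x) = (2 * qRe p) *\<^sub>R ?Q x - ?Q (p *\<^sub>l x)"
    by (simp only: quat_cnj_eq lmul_diff_left lmul_of_real Q.scale Q.diff)
  then have 2: "A (?Q (quat_cnj p *\<^sub>l x)) = (2 * qRe p) *\<^sub>R A (?Q x) - A (?Q (p *\<^sub>l x))"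
    by (simp only: right_linear_on_diff[OF D A right_submodule_scaleR[OF D mem(1)] mem(1)]
        right_linear_on_scaleR[OF A mem(1)])
  show ?thesis
    unfolding S_resolvent_op_eq right_linear_on_diff[OF D A mem] 1 2 A_A_Q_op[OF p]
    by (simp add: algebra_simps)
qed

lemma S_resolvent_equation:
  fixes A :: "'a::quat_banach_bimodule \<Rightarrow> 'a"
  assumes D: "right_submodule D" and A: "right_linear_on D A" and clo: "closed_operator D A"
    and p: "p \<in> S_resolvent_set D A" and q: "q \<in> S_resolvent_set D A"
  shows "S_resolvent_op D A p x - S_resolvent_op D A q x =
    Q_op D A q ((q - p) *\<^sub>l x) + Q_op D A q (S_resolvent_op D A p (quat_Delta q p *\<^sub>l x))"
proof -
  let ?S = "S_resolvent_op D A p" and ?Q = "Q_op D A q"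
  let ?a = "2 * qRe q" and ?b = "(norm q)\<^sup>2"
  interpret Q: linear ?Q
    using Q_op_linear[OF q] .
  interpret S: linear ?S
    using S_resolvent_op_bounded_right_linear[OF A clo p] right_linear_on_UNIV_linear
    by (auto simp: bounded_right_linear_iff)
  note Smem = S_resolvent_op_mem[OF D p] and Qmem = Q_op_mem[OF q]
    and Slmul = S_resolvent_op_lmul[OF D A p]
  define w where "w = ?S x + A (?Q x)"
  have Aw: "A w = ?S (p *\<^sub>l x) + ?a *\<^sub>R A (?Q x) - ?b *\<^sub>R ?Q x"
    unfolding w_def right_linear_on_add[OF A Smem Qmem(2)] A_A_Q_op[OF q] Slmul
    by simp
  (* All three terms of A w lie in D: this is what puts w into D(A^2). *)
  have mem: "w \<in> D" "A w \<in> D"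
    unfolding Aw unfolding w_def
    by (intro right_submodule_add[OF D] right_submodule_diff[OF D] right_submodule_scaleR[OF D]
        Smem Qmem)+
  have "A (A w) = A (?S (p *\<^sub>l x)) + ?a *\<^sub>R A (A (?Q x)) - ?b *\<^sub>R A (?Q x)"
    unfolding Aw
    by (simp add: right_linear_on_diff[OF D A] right_linear_on_add[OF A]
        right_linear_on_scaleR[OF A] right_submodule_add[OF D] right_submodule_scaleR[OF D]
        Smem Qmem)
  then have Delta_w: "Delta_op A q w = A (?S (p *\<^sub>l x)) - ?a *\<^sub>R A (?S x) + ?b *\<^sub>R ?S x"
    unfolding Delta_op_eq w_def right_linear_on_add[OF A Smem Qmem(2)]
    by (simp add: algebra_simps)
  have "quat_Delta q p *\<^sub>l x = p *\<^sub>l (p *\<^sub>l x) - ?a *\<^sub>R (p *\<^sub>l x) + ?b *\<^sub>R x"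
    unfolding quat_Delta_def power2_eq_square[of p] lmul_add_left lmul_diff_left
    by (simp only: lmul_of_real lmul_lmul[symmetric])
  then have S_Delta: "?S (quat_Delta q p *\<^sub>l x) =
      A (?S (p *\<^sub>l x)) + p *\<^sub>l x - ?a *\<^sub>R (A (?S x) + x) + ?b *\<^sub>R ?S x"
    by (simp only: S.add S.diff S.scale Slmul)
  have scalars: "quat_cnj q *\<^sub>l x + (q - p) *\<^sub>l x = ?a *\<^sub>R x - p *\<^sub>l x"
    unfolding quat_cnj_eq lmul_diff_left lmul_of_real by simp
  have "Delta_op A q w =
      quat_cnj q *\<^sub>l x + (q - p) *\<^sub>l x + ?S (quat_Delta q p *\<^sub>l x)"
    unfolding Delta_w S_Delta scalars by (simp add: algebra_simps)
  then have "w = ?Q (quat_cnj q *\<^sub>l x) + ?Q ((q - p) *\<^sub>l x) + ?Q (?S (quat_Delta q p *\<^sub>l x))"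
    using Q_op_Delta_op[OF q mem] by (simp only: Q.add)
  then show ?thesis
    unfolding w_def S_resolvent_op_eq[of D A q] by (simp add: algebra_simps)
qed

theorem theorem2p8:
  fixes A :: "'a::quat_banach_bimodule \<Rightarrow> 'a" and D :: "'a set"
  assumes "right_submodule D"
    and "right_linear_on D A"
    and "closed_operator D A"
  shows "(\<forall>q \<in> S_resolvent_set D A. S_resolvent_op D A q \<in> bounded_right_linear) \<and>
    (\<forall>p \<in> S_resolvent_set D A. \<forall>q \<in> S_resolvent_set D A.
      (\<lambda>x. S_resolvent_op D A p x - S_resolvent_op D A q x) =
      (\<lambda>x. (Q_op D A q \<odot> (q - p)) x +
        ((Q_op D A q \<circ> S_resolvent_op D A p) \<odot> quat_Delta q p) x))"
  using S_resolvent_op_bounded_right_linear[OF assms(2,3)] S_resolvent_equation[OF assms]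
  by (simp add: op_scal_def)

end
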